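(* Let $\mathfrak{A}$ be a residuated lattice. The following assertions are equivalent: (1) $\mathfrak{A}$ is quasicomplemented and disjunctive; (2) $\ell(\mathfrak{A})$ is a Boolean lattice; (3) $\mathfrak{A}$ is quasicomplemented, $\mathfrak{d}(\mathfrak{A})=\{0\}$, and the operation $\neg: A\to A$ is injective as a function.
   Context: A residuated lattice $\mathfrak{A}=(A;\vee,\wedge,\odot,\rightarrow,0,1)$ is an algebra such that $\ell(\mathfrak{A}):=(A;\vee,\wedge,0,1)$ is a bounded lattice, $(A;\odot,1)$ is a commutative monoid, and $x\odot y\leq z$ iff $x\leq y\rightarrow z$. Put $\neg a:=a\rightarrow 0$. For $X\subseteq A$, $X^{\perp}=\{a\in A\mid a\vee x=1\ \forall x\in X\}$; $x^{\perp}:=\{x\}^{\perp}$ and $x^{\perp\perp}:=(x^{\perp})^{\perp}$. An element $x$ is dense if $x^{\perp}=\{1\}$; $\mathfrak{d}(\mathfrak{A})$ is the set of dense elements. $\mathfrak{A}$ is quasicomplemented if for every $x\in A$ there is $y\in A$ with $x^{\perp\perp}=y^{\perp}$. $\mathfrak{A}$ is disjunctive if the map $x\mapsto x^{\perp}$ on $A$ is injective. *)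

theory Defs
  imports Main
begin

text \<open>
  The bottom and top of the lattice, \<^const>\<open>bot\<close> and \<^const>\<open>top\<close>, are the constants
  written 0 and 1 in the mathematics. The unit of the monoid is a separate class parameter,
  which \<open>one_eq_top\<close> identifies with the top.
\<close>

class residuated_lattice = bounded_lattice + comm_monoid_mult +
  fixes residuum :: "'a \<Rightarrow> 'a \<Rightarrow> 'a"  (infixr "\<^bold>\<rightarrow>" 60)
  assumes one_eq_top: "1 = top"
    and residuation: "x * y \<le> z \<longleftrightarrow> x \<le> (y \<^bold>\<rightarrow> z)"

definition neg :: "'a::residuated_lattice \<Rightarrow> 'a"
  where "neg a = (a \<^bold>\<rightarrow> bot)"

definition perp :: "'a::residuated_lattice set \<Rightarrow> 'a set"
  where "perp X = {a. \<forall>x\<in>X. sup a x = top}"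

definition dense_elements :: "'a::residuated_lattice set"
  where "dense_elements = {x. perp {x} = {top}}"

text \<open>
  The following properties of the whole algebra take its carrier type as argument.
\<close>

definition quasicomplemented :: "'a::residuated_lattice itself \<Rightarrow> bool"
  where "quasicomplemented _ \<longleftrightarrow> (\<forall>x::'a. \<exists>y::'a. perp (perp {x}) = perp {y})"

definition disjunctive :: "'a::residuated_lattice itself \<Rightarrow> bool"
  where "disjunctive _ \<longleftrightarrow> inj (\<lambda>x::'a. perp {x})"

text \<open>
  A Boolean lattice is a complemented distributive bounded lattice. The type class
  \<^class>\<open>boolean_algebra\<close> fixes complementation as an operation, which is not part of
  the lattice reduct, so existence of complements is stated here instead.
\<close>

definition boolean_lattice :: "'a::bounded_lattice itself \<Rightarrow> bool"
  where "boolean_lattice _ \<longleftrightarrow>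
    class.distrib_lattice (inf :: 'a \<Rightarrow> 'a \<Rightarrow> 'a) (\<le>) (<) sup \<and>
    (\<forall>x::'a. \<exists>y. inf x y = bot \<and> sup x y = top)"

end

theory Submission
  imports Defs
begin

text \<open>
  Conditions (1) and (3) both force \<^const>\<open>bot\<close> to be the only dense element: it is dense, and
  disjunctivity identifies all dense elements. If \<open>y\<close> is a quasicomplement of \<open>x\<close>, then
  \<open>x \<squnion> y = top\<close> and \<open>x \<sqinter> y\<close> is dense, so \<open>y\<close> is a lattice complement of \<open>x\<close>. Once \<open>x\<close> is
  complemented, \<open>x \<sqinter> z = x * z\<close> for all \<open>z\<close>, so distributivity of the lattice is inherited from
  that of multiplication over joins.
\<close>

text \<open>By \<open>residuation\<close>, multiplication by \<open>x\<close> is a left adjoint,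
  hence preserves joins.\<close>

lemma mult_sup_distrib:
  fixes x y z :: "'a::residuated_lattice"
  shows "x * sup y z = sup (x * y) (x * z)"
proof (rule order.antisym)
  have "y \<le> (x \<^bold>\<rightarrow> sup (x * y) (x * z))" "z \<le> (x \<^bold>\<rightarrow> sup (x * y) (x * z))"
    by (simp_all add: residuation[symmetric] mult.commute)
  then have "sup y z * x \<le> sup (x * y) (x * z)"
    by (simp add: residuation)
  then show "x * sup y z \<le> sup (x * y) (x * z)"
    by (simp add: mult.commute)
next
  have mono: "u * x \<le> v * x" if "u \<le> v" for u v :: 'a
    using order.trans[OF that] residuation by blast
  show "sup (x * y) (x * z) \<le> x * sup y z"
    using mono[of y "sup y z"] mono[of z "sup y z"] by (simp add: mult.commute)
qed

lemma mult_left_mono_rl: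
  fixes x y z :: "'a::residuated_lattice"
  assumes "y \<le> z"
  shows "x * y \<le> x * z"
  using mult_sup_distrib[of x y z] assms by (simp add: sup_absorb2 le_iff_sup)

lemma mult_top: "x * top = (x :: 'a::residuated_lattice)"
  by (metis one_eq_top mult.right_neutral)

lemma top_mult: "top * x = (x :: 'a::residuated_lattice)"
  by (metis one_eq_top mult.left_neutral)

lemma mult_le_inf: "x * y \<le> inf x (y :: 'a::residuated_lattice)"
  using mult_left_mono_rl[of y top x] mult_left_mono_rl[of x top y]
  by (simp add: mult_top top_mult mult.commute)

text \<open>Multiplying \<open>inf x z\<close> by \<open>top = sup x y\<close> and distributing
  splits it into a part below \<open>x * z\<close> and a part below
  \<open>inf x y = bot\<close>.\<close>

lemma inf_eq_mult_if_complemented: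
  fixes x y z :: "'a::residuated_lattice"
  assumes "inf x y = bot" "sup x y = top"
  shows "inf x z = x * z"
proof (rule order.antisym)
  have "y * inf x z \<le> inf x y"
    using mult_le_inf[of y "inf x z"] by (auto intro: le_infI2 order.trans)
  moreover have "x * inf x z \<le> x * z"
    by (simp add: mult_left_mono_rl)
  ultimately show "inf x z \<le> x * z"
    using mult_sup_distrib[of "inf x z" x y] assms
    by (simp add: mult_top top_mult mult.commute bot_unique)
qed (rule mult_le_inf)

lemma neg_eq_complement:
  fixes x y :: "'a::residuated_lattice"
  assumes "inf x y = bot" "sup x y = top"
  shows "neg x = y"
proof (rule order.antisym)
  have "neg x * x \<le> bot"
    by (simp add: residuation neg_def)
  \<comment> \<open>Expand \<open>neg x * sup x y\<close>; the summand \<open>neg x * x\<close>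
    vanishes.\<close>
  then have "neg x = neg x * y"
    using mult_sup_distrib[of "neg x" x y] assms by (simp add: mult_top bot_unique)
  then show "neg x \<le> y"
    using mult_le_inf[of "neg x" y] by simp
  have "y * x \<le> bot"
    using mult_le_inf[of y x] assms by (simp add: inf.commute)
  then show "y \<le> neg x"
    by (simp add: residuation neg_def)
qed

text \<open>As \<open>y * x\<close> vanishes, multiplying \<open>y\<close> by
  \<open>sup a x = top\<close> leaves only \<open>y * a\<close>, which lies below
  \<open>a\<close>.\<close>

lemma complement_le_if_sup_eq_top:
  fixes x y a :: "'a::residuated_lattice"
  assumes "inf x y = bot" "sup a x = top"
  shows "y \<le> a"
proof -
  have "y * x = bot"
    using mult_le_inf[of y x] assms by (simp add: inf.commute bot_unique)
  then have "y = y * a"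
    using mult_sup_distrib[of y a x] assms by (simp add: mult_top)
  then show ?thesis
    using mult_le_inf[of y a] by simp
qed

lemma perp_complemented:
  fixes x y :: "'a::residuated_lattice"
  assumes "inf x y = bot" "sup x y = top"
  shows "perp {x} = {y..}"
proof -
  have "sup a x = top" if "y \<le> a" for a
    using assms(2) sup_mono[OF that order.refl[of x]] by (simp add: sup.commute top_unique)
  then show ?thesis
    using complement_le_if_sup_eq_top[OF assms(1)] by (auto simp: perp_def)
qed

text \<open>The condition \<open>sup a x = top\<close> persists when \<open>x\<close> grows, so the
  least element of the filter decides. Together with \<open>perp_complemented\<close> this computes
  double perps: a complement is a quasicomplement.\<close>

lemma perp_atLeast: "perp {y..} = perp {y :: 'a::residuated_lattice}"
proof -
  have "sup a x = top" if "sup a y = top" "y \<le> x" for a x :: 'a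
    using sup_mono[OF order.refl[of a] that(2)] that(1) by (simp add: top_unique)
  then show ?thesis
    by (auto simp: perp_def)
qed

lemma bot_dense: "(bot :: 'a::residuated_lattice) \<in> dense_elements"
  by (auto simp: dense_elements_def perp_def)

lemma dense_elements_if_disjunctive:
  assumes "disjunctive TYPE('a::residuated_lattice)"
  shows "(dense_elements :: 'a set) = {bot}"
  using assms bot_dense unfolding disjunctive_def dense_elements_def
  by (auto dest: injD)

lemma boolean_lattice_if_quasicomplemented:
  assumes qc: "quasicomplemented TYPE('a::residuated_lattice)"
    and dense: "(dense_elements :: 'a set) = {bot}"
  shows "boolean_lattice TYPE('a)"
proof -
  have compl: "\<exists>y. inf x y = bot \<and> sup x y = top" for x :: 'a
  proof -
    obtain y where y: "perp (perp {x}) = perp {y}"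
      using qc by (auto simp: quasicomplemented_def)
    have "x \<in> perp (perp {x})"
      by (auto simp: perp_def sup.commute)
    then have "sup x y = top"
      unfolding y by (simp add: perp_def)
    \<comment> \<open>Such an \<open>a\<close> lies in both \<open>perp {x}\<close> and its
      \<open>perp\<close>, so it is orthogonal to itself.\<close>
    moreover have "a = top" if a: "sup a (inf x y) = top" for a
    proof -
      have "sup a x = top" "sup a y = top"
        using a sup_mono[of a a "inf x y" x] sup_mono[of a a "inf x y" y]
        by (simp_all add: top_unique)
      then have "a \<in> perp {x}" "a \<in> perp (perp {x})"
        unfolding y by (simp_all add: perp_def)
      then have "sup a a = top"
        unfolding perp_def[of "perp {x}"] by blast
      then show ?thesis by simp
    qed
    then have "inf x y \<in> dense_elements"
      by (auto simp: dense_elements_def perp_def)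
    then have "inf x y = bot"
      using dense by blast
    ultimately show ?thesis by blast
  qed
  have inf_mult: "inf x z = x * z" for x z :: 'a
    using compl inf_eq_mult_if_complemented by blast
  have "inf x (sup y z) = sup (inf x y) (inf x z)" for x y z :: 'a
    by (simp only: inf_mult mult_sup_distrib)
  \<comment> \<open>The class axiom is the dual distributive law.\<close>
  then have "sup x (inf y z) = inf (sup x y) (sup x z)" for x y z :: 'a
    using distrib_imp1 by blast
  then have "class.distrib_lattice (inf :: 'a \<Rightarrow> 'a \<Rightarrow> 'a) (\<le>) (<) sup"
    by unfold_locales
  then show ?thesis
    using compl by (simp add: boolean_lattice_def)
qed

lemma quasicomplemented_if_boolean_lattice:
  assumes "boolean_lattice TYPE('a::residuated_lattice)"
  shows "quasicomplemented TYPE('a)"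
  unfolding quasicomplemented_def
proof
  fix x :: 'a
  obtain y where "inf x y = bot" "sup x y = top"
    using assms by (auto simp: boolean_lattice_def)
  then show "\<exists>y. perp (perp {x}) = perp {y}"
    using perp_complemented perp_atLeast by metis
qed

lemma disjunctive_if_boolean_lattice:
  assumes "boolean_lattice TYPE('a::residuated_lattice)"
  shows "disjunctive TYPE('a)"
  unfolding disjunctive_def
proof (rule injI)
  fix x x' :: 'a
  assume eq: "perp {x} = perp {x'}"
  obtain y y' where y: "inf x y = bot" "sup x y = top" and y': "inf x' y' = bot" "sup x' y' = top"
    using assms unfolding boolean_lattice_def by blast
  \<comment> \<open>The complement is recovered as the least element of the perp; negating it then
    returns the original element.\<close>
  have "y = y'"
    using eq perp_complemented[OF y] perp_complemented[OF y'] by simp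
  moreover have "neg y = x" "neg y' = x'"
    using y y' neg_eq_complement by (metis inf.commute sup.commute)+
  ultimately show "x = x'" by simp
qed

lemma inj_neg_if_boolean_lattice:
  assumes "boolean_lattice TYPE('a::residuated_lattice)"
  shows "inj (neg :: 'a \<Rightarrow> 'a)"
proof (rule inj_on_inverseI)
  fix x :: 'a
  obtain y where "inf x y = bot" "sup x y = top"
    using assms by (auto simp: boolean_lattice_def)
  \<comment> \<open>Being a complement is symmetric, so \<open>neg\<close> swaps \<open>x\<close>
    and \<open>y\<close>.\<close>
  then show "neg (neg x) = x"
    using neg_eq_complement by (metis inf.commute sup.commute)
qed

theorem proposition4p3:
  shows "(quasicomplemented TYPE('a::residuated_lattice) \<and> disjunctive TYPE('a)
            \<longleftrightarrow> boolean_lattice TYPE('a)) \<and>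
         (boolean_lattice TYPE('a)
            \<longleftrightarrow> quasicomplemented TYPE('a) \<and> (dense_elements :: 'a set) = {bot} \<and>
                inj (neg :: 'a \<Rightarrow> 'a))"
  \<comment> \<open>For a Boolean lattice, the equation for \<open>dense_elements\<close> is reached
    through disjunctivity.\<close>
  using dense_elements_if_disjunctive boolean_lattice_if_quasicomplemented
    quasicomplemented_if_boolean_lattice disjunctive_if_boolean_lattice inj_neg_if_boolean_lattice
  by blast

end
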